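(* Let $f=A_s+\cdots$ be a formal vector field on $\mathbb C^n$ in Poincaré–Dulac normal form, where $A_s$ is the semisimple part of its linear part. Then: (a) The divergence $\mathrm{div}\,f$ is a first integral of $A_s$. (b) If $\psi$ is a formal inverse Jacobi multiplier of $f$, then $X_{A_s}(\psi)=\mathrm{div}\,A_s\cdot\psi$.
   Context: Formal vector fields on $\mathbb C^n$ are elements of $\mathbb C[[x_1,\ldots,x_n]]^n$; a matrix $B$ is identified with the linear vector field $x\mapsto Bx$. $[g,h](x)=Dh(x)g(x)-Dg(x)h(x)$, $X_g(\phi)(x)=D\phi(x)g(x)$; $\phi$ is a first integral of $g$ if $X_g(\phi)=0$ (constants included). $f(x)=Ax+\text{(terms of degree}\ge2)$ is in Poincaré–Dulac normal form if $[A_s,f]=0$, with $A_s$ the semisimple part of $A$. $\mathrm{div}\,f=\mathrm{tr}\,Df$. A formal inverse Jacobi multiplier of $f$ is a formal power series $\psi\ne0$ with $X_f(\psi)=\mathrm{div}f\cdot\psi$. *)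

theory Defs
  imports "HOL-Analysis.Analysis" "HOL-Library.Multiset"
begin

section \<open>Formal power series in several indeterminates\<close>

text \<open>
  The indeterminates are indexed by \<open>'n\<close>. The multiset \<open>m\<close> of indices stands for the monomial
  \<open>\<Prod>i. x\<^sub>i ^ count m i\<close>: sums of multisets are products of monomials, \<open>\<subseteq>#\<close> is divisibility, and
  \<open>size m\<close> is the degree.
\<close>

typedef ('a, 'n) mfps = "UNIV :: ('n multiset \<Rightarrow> 'a) set"
  morphisms mfps_nth Abs_mfps
  by simp

setup_lifting type_definition_mfps

lemma mfps_eqI: "(\<And>m. mfps_nth f m = mfps_nth g m) \<Longrightarrow> f = g"
  by (simp add: mfps_nth_inject[symmetric] fun_eq_iff)

lemma finite_submultisets: "finite {a. a \<subseteq># (m :: 'n multiset)}"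
proof (induction m)
  case empty
  then show ?case by simp
next
  case (add x m)
  have "{a. a \<subseteq># add_mset x m} \<subseteq> {a. a \<subseteq># m} \<union> add_mset x ` {a. a \<subseteq># m}"
  proof
    fix a assume "a \<in> {a. a \<subseteq># add_mset x m}"
    then have a: "a \<subseteq># add_mset x m" by simp
    show "a \<in> {a. a \<subseteq># m} \<union> add_mset x ` {a. a \<subseteq># m}"
    proof (cases "x \<in># a")
      case True
      then obtain b where "a = add_mset x b" by (meson multi_member_split)
      with a show ?thesis by simp
    next
      case False
      have "count a y \<le> count m y" for y
      proof (cases "y = x")
        case True
        then show ?thesis using False by (simp add: not_in_iff)
      next
        case ne: False
        have "count a y \<le> count (add_mset x m) y" using a by (simp add: subseteq_mset_def)
        with ne show ?thesis by simp
      qed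
      then show ?thesis by (simp add: subseteq_mset_def)
    qed
  qed
  then show ?case by (rule finite_subset) (use add.IH in simp)
qed

instantiation mfps :: (comm_ring_1, type) comm_ring_1
begin

lift_definition zero_mfps :: "('a, 'b) mfps" is "\<lambda>m. 0" .
lift_definition one_mfps :: "('a, 'b) mfps" is "\<lambda>m. if m = {#} then 1 else 0" .
lift_definition plus_mfps :: "('a, 'b) mfps \<Rightarrow> ('a, 'b) mfps \<Rightarrow> ('a, 'b) mfps"
  is "\<lambda>f g m. f m + g m" .
lift_definition minus_mfps :: "('a, 'b) mfps \<Rightarrow> ('a, 'b) mfps \<Rightarrow> ('a, 'b) mfps"
  is "\<lambda>f g m. f m - g m" .
lift_definition uminus_mfps :: "('a, 'b) mfps \<Rightarrow> ('a, 'b) mfps" is "\<lambda>f m. - f m" .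
lift_definition times_mfps :: "('a, 'b) mfps \<Rightarrow> ('a, 'b) mfps \<Rightarrow> ('a, 'b) mfps"
  is "\<lambda>f g m. \<Sum>a | a \<subseteq># m. f a * g (m - a)" .

instance
proof
  fix f g h :: "('a, 'b) mfps"
  show "f * g * h = f * (g * h)"
  proof (rule mfps_eqI)
    fix m :: "'b multiset"
    let ?F = "mfps_nth f" and ?G = "mfps_nth g" and ?H = "mfps_nth h"
    have "mfps_nth (f * g * h) m
        = (\<Sum>(a, b) \<in> Sigma {a. a \<subseteq># m} (\<lambda>a. {b. b \<subseteq># a}). ?F b * ?G (a - b) * ?H (m - a))"
      by (simp add: times_mfps.rep_eq sum_distrib_right sum.Sigma finite_submultisets)
    also have "\<dots> = (\<Sum>(b, c) \<in> Sigma {b. b \<subseteq># m} (\<lambda>b. {c. c \<subseteq># m - b}).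
        ?F b * (?G c * ?H (m - b - c)))"
      by (rule sum.reindex_bij_witness[where i = "\<lambda>(b, c). (b + c, b)" and j = "\<lambda>(a, b). (b, a - b)"])
        (auto simp: subset_mset.add_diff_inverse mult.assoc subset_mset.le_diff_conv2
          add.commute intro: subset_mset.order_trans)
    also have "\<dots> = mfps_nth (f * (g * h)) m"
      by (simp add: times_mfps.rep_eq sum_distrib_left sum.Sigma finite_submultisets)
    finally show "mfps_nth (f * g * h) m = mfps_nth (f * (g * h)) m" .
  qed
  show "f * g = g * f"
  proof (rule mfps_eqI)
    fix m :: "'b multiset"
    show "mfps_nth (f * g) m = mfps_nth (g * f) m"
      unfolding times_mfps.rep_eq
      by (rule sum.reindex_bij_witness[where i = "\<lambda>a. m - a" and j = "\<lambda>a. m - a"])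
        (auto simp: subset_mset.diff_diff_right mult.commute)
  qed
  show "1 * f = f"
  proof (rule mfps_eqI)
    fix m :: "'b multiset"
    have "mfps_nth (1 * f) m
        = (\<Sum>a | a \<subseteq># m. if a = {#} then mfps_nth f m else 0)"
      unfolding times_mfps.rep_eq one_mfps.rep_eq by (rule sum.cong) auto
    also have "\<dots> = mfps_nth f m"
      by (simp add: finite_submultisets)
    finally show "mfps_nth (1 * f) m = mfps_nth f m" .
  qed
  show "(f + g) * h = f * h + g * h"
    by (rule mfps_eqI)
      (simp add: times_mfps.rep_eq plus_mfps.rep_eq distrib_right sum.distrib)
  show "(0 :: ('a, 'b) mfps) \<noteq> 1"
    by (metis one_mfps.rep_eq zero_mfps.rep_eq zero_neq_one)
qed (rule mfps_eqI; simp add: plus_mfps.rep_eq minus_mfps.rep_eq uminus_mfps.rep_eq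
    zero_mfps.rep_eq algebra_simps)+

end

lift_definition mfps_const :: "'a::zero \<Rightarrow> ('a, 'n) mfps"
  is "\<lambda>c m. if m = {#} then c else 0" .

lift_definition mfps_X :: "'n \<Rightarrow> ('a::zero_neq_one, 'n) mfps"
  is "\<lambda>i m. if m = {#i#} then 1 else 0" .

lift_definition mfps_deriv :: "'n \<Rightarrow> ('a::semiring_1, 'n) mfps \<Rightarrow> ('a, 'n) mfps"
  is "\<lambda>i f m. of_nat (Suc (count m i)) * f (add_mset i m)" .


section \<open>Formal vector fields\<close>

type_synonym 'n formal_vf = "(complex, 'n) mfps ^ 'n"

definition linear_vf :: "complex ^ 'n ^ 'n \<Rightarrow> ('n::finite) formal_vf" where
  "linear_vf B = (\<chi> i. \<Sum>j\<in>UNIV. mfps_const (B $ i $ j) * mfps_X j)"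

definition linear_part :: "('n::finite) formal_vf \<Rightarrow> complex ^ 'n ^ 'n" where
  "linear_part f = (\<chi> i j. mfps_nth (f $ i) {#j#})"

definition jacobian_matrix :: "('n::finite) formal_vf \<Rightarrow> (complex, 'n) mfps ^ 'n ^ 'n" where
  "jacobian_matrix f = (\<chi> i j. mfps_deriv j (f $ i))"

definition formal_div :: "('n::finite) formal_vf \<Rightarrow> (complex, 'n) mfps" where
  "formal_div f = trace (jacobian_matrix f)"

definition lie_bracket :: "('n::finite) formal_vf \<Rightarrow> 'n formal_vf \<Rightarrow> 'n formal_vf" where
  "lie_bracket g h = jacobian_matrix h *v g - jacobian_matrix g *v h"

definition lie_derivative :: "('n::finite) formal_vf \<Rightarrow> (complex, 'n) mfps \<Rightarrow> (complex, 'n) mfps" where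
  "lie_derivative g \<phi> = (\<Sum>j\<in>UNIV. mfps_deriv j \<phi> * g $ j)"

definition first_integral :: "('n::finite) formal_vf \<Rightarrow> (complex, 'n) mfps \<Rightarrow> bool" where
  "first_integral g \<phi> \<longleftrightarrow> lie_derivative g \<phi> = 0"

definition inverse_jacobi_multiplier :: "('n::finite) formal_vf \<Rightarrow> (complex, 'n) mfps \<Rightarrow> bool" where
  "inverse_jacobi_multiplier f \<psi> \<longleftrightarrow> \<psi> \<noteq> 0 \<and> lie_derivative f \<psi> = formal_div f * \<psi>"


section \<open>Semisimple part and normal forms\<close>

text \<open>Over \<open>\<complex>\<close>, semisimple means diagonalizable.\<close>

definition semisimple_matrix :: "complex ^ 'n ^ 'n \<Rightarrow> bool" where
  "semisimple_matrix S \<longleftrightarrow>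
    (\<exists>P D :: complex ^ 'n ^ 'n. invertible P \<and> (\<forall>i j. i \<noteq> j \<longrightarrow> D $ i $ j = 0) \<and> S = P ** D ** matrix_inv P)"

text \<open>The power is iterated \<open>**\<close>; the overloaded \<open>^\<close> on type \<open>vec\<close> is componentwise.\<close>

definition nilpotent_matrix :: "complex ^ 'n ^ 'n \<Rightarrow> bool" where
  "nilpotent_matrix N \<longleftrightarrow> (\<exists>k. ((\<lambda>M. N ** M) ^^ k) (mat 1) = 0)"

text \<open>Jordan--Chevalley decomposition \<open>A = S + (A - S)\<close>, which exists and is unique.\<close>

definition is_semisimple_part :: "complex ^ 'n ^ 'n \<Rightarrow> complex ^ 'n ^ 'n \<Rightarrow> bool" where
  "is_semisimple_part A S \<longleftrightarrow>
    semisimple_matrix S \<and> nilpotent_matrix (A - S) \<and> S ** (A - S) = (A - S) ** S"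

text \<open>The first conjunct says that \<open>f\<close> has no constant term.\<close>

definition poincare_dulac_normal_form :: "('n::finite) formal_vf \<Rightarrow> complex ^ 'n ^ 'n \<Rightarrow> bool" where
  "poincare_dulac_normal_form f A\<^sub>s \<longleftrightarrow>
    (\<forall>i. mfps_nth (f $ i) {#} = 0) \<and>
    is_semisimple_part (linear_part f) A\<^sub>s \<and>
    lie_bracket (linear_vf A\<^sub>s) f = 0"

end

theory Submission
  imports Defs "HOL-Computational_Algebra.Fundamental_Theorem_Algebra"
begin

text \<open>
  The operator \<open>J\<^sub>g \<phi> = X\<^sub>g \<phi> - div g \<cdot> \<phi>\<close> satisfies \<open>J\<^bsub>[g,h]\<^esub> = J\<^sub>g J\<^sub>h - J\<^sub>h J\<^sub>g\<close>, so
  \<open>L = J\<^bsub>A\<^sub>s\<^esub>\<close> commutes with \<open>J\<^sub>f\<close> and with \<open>N = J\<^sub>f - L\<close>. The linear part of \<open>f - A\<^sub>s\<close> is nilpotent, in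
  particular of trace zero, so powers of \<open>N\<close> push every series into arbitrarily high degree. If
  \<open>J\<^sub>f \<psi> = 0\<close>, then \<open>L \<psi> = - N \<psi>\<close> and hence \<open>L\<^sup>k \<psi> = (- N)\<^sup>k \<psi>\<close>, which vanishes below any given degree
  for large \<open>k\<close>. Since \<open>L\<close> is graded and diagonalizable on polynomials, \<open>L \<psi> = 0\<close>.
\<close>

subsection \<open>The trace of a nilpotent matrix\<close>

text \<open>From \<open>v = - t N v\<close> one gets \<open>v = (- t)^j N^j v\<close> for every
  \<open>j\<close>, and some power of \<open>N\<close> vanishes. Hence \<open>1 + t N\<close> is
  injective for every \<open>t\<close>.\<close>

lemma nilpotent_ker_trivial:
  fixes N :: "complex ^ 'n ^ 'n"
  assumes "nilpotent_matrix N" and v: "v + t *s (N *v v) = 0"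
  shows "v = 0"
proof -
  obtain k where k: "((\<lambda>M. N ** M) ^^ k) (mat 1) = 0"
    using assms(1) by (auto simp: nilpotent_matrix_def)
  have v': "v = (- t) *s (N *v v)"
    using v by (simp add: eq_neg_iff_add_eq_0 vector_scalar_mult_def vec_eq_iff)
  have "v = (- t) ^ j *s (((\<lambda>M. N ** M) ^^ j) (mat 1) *v v)" for j
  proof (induction j)
    case (Suc j)
    have "v = (- t) *s (N *v ((- t) ^ j *s (((\<lambda>M. N ** M) ^^ j) (mat 1) *v v)))"
      by (subst Suc.IH[symmetric]) (rule v')
    then show ?case
      by (simp add: vector_scalar_commute matrix_vector_mul_assoc)
  qed simp
  from this[of k] show ?thesis
    by (simp add: k)
qed


text \<open>The polynomial \<open>det (1 + t N)\<close> in \<open>t\<close> has no roots, hence is constant; its linear coefficient is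
  the trace of \<open>N\<close>.\<close>
lemma trace_nilpotent_matrix:
  fixes N :: "complex ^ 'n ^ 'n"
  assumes "nilpotent_matrix N"
  shows "trace N = 0"
proof -
  define M :: "complex poly ^ 'n ^ 'n" where
    "M = (\<chi> i j. [:(if i = j then 1 else 0), N $ i $ j:])"
  have poly_det: "poly (det M) t = det (\<chi> i j. (if i = j then 1 else 0) + t * N $ i $ j)" for t
    by (simp add: det_def M_def poly_sum poly_prod)
  have "poly (det M) t \<noteq> 0" for t
  proof -
    let ?B = "(\<chi> i j. (if i = j then 1 else 0) + t * N $ i $ j) :: complex ^ 'n ^ 'n"
    have "?B *v v = v + t *s (N *v v)" for v
      by (simp add: vec_eq_iff matrix_vector_mult_def distrib_right sum.distrib
          if_distrib[of "\<lambda>x. x * _"] sum_distrib_left mult.assoc cong: if_cong)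
    then have "\<forall>v. ?B *v v = 0 \<longrightarrow> v = 0"
      by (auto intro: nilpotent_ker_trivial[OF assms])
    then show ?thesis
      unfolding poly_det
      using invertible_det_nz[of ?B] invertible_left_inverse[of ?B] matrix_left_invertible_ker[of ?B]
      by simp
  qed
  then have "degree (det M) = 0"
    using fundamental_theorem_of_algebra[of "det M"] by (auto simp: constant_degree)
  then have "poly (pderiv (det M)) 0 = 0"
    by (metis pderiv_eq_0_iff poly_0)
  \<comment> \<open>Product rule in each Leibniz term: at 0 an undifferentiated factor
    \<open>j\<close> is 1 or 0 according to whether \<open>p\<close> fixes \<open>j\<close>, and the
    differentiated factor \<open>i\<close> leaves the entry of \<open>N\<close> at \<open>i\<close>,
    \<open>p i\<close>.\<close>
  also have "poly (pderiv (det M)) 0 = (\<Sum>p | p permutes (UNIV :: 'n set). of_int (sign p) *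
      (\<Sum>i\<in>UNIV. (\<Prod>j\<in>UNIV - {i}. if j = p j then 1 else 0) * N $ i $ p i))"
    by (simp add: det_def M_def higher_pderiv_sum[of 1, simplified] pderiv_smult of_int_poly pderiv_prod pderiv_pCons
        poly_sum poly_prod sum_distrib_left mult_ac)
  also have "\<dots> = (\<Sum>p | p permutes (UNIV :: 'n set). if p = id then trace N else 0)"
  proof (rule sum.cong)
    fix p assume "p \<in> {p. p permutes (UNIV :: 'n set)}"
    then have inj: "inj p" by (auto dest: permutes_inj)
    show "of_int (sign p) * (\<Sum>i\<in>UNIV. (\<Prod>j\<in>UNIV - {i}. if j = p j then 1 else 0) * N $ i $ p i)
        = (if p = id then trace N else 0)"
    proof (cases "p = id")
      case True
      then show ?thesis by (simp add: trace_def sign_id)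
    next
      case False
      \<comment> \<open>Both \<open>a\<close> and \<open>p a\<close> are moved by \<open>p\<close>,
        so whichever factor \<open>i\<close> was differentiated, one of the two still contributes a
        zero factor.\<close>
      then obtain a where a: "p a \<noteq> a" by (auto simp: fun_eq_iff)
      then have a': "p (p a) \<noteq> p a" using inj by (simp add: inj_eq)
      have prod0: "(\<Prod>j\<in>UNIV - {i}. if j = p j then 1 else 0 :: complex) = 0" for i
      proof -
        have "\<exists>j\<in>UNIV - {i}. j \<noteq> p j"
          using a a' by (intro bexI[of _ "if a = i then p a else a"]) auto
        then show ?thesis by (auto intro: prod_zero)
      qed
      from False show ?thesis
        by (simp only: prod0 mult_zero_left mult_zero_right sum.neutral_const if_False)
    qed
  qed simp
  also have "\<dots> = trace N"
    by (simp add: permutes_id finite_permutations)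
  finally show ?thesis by simp
qed


subsection \<open>Coefficients and constants\<close>

lemmas mfps_nth_simps = zero_mfps.rep_eq one_mfps.rep_eq plus_mfps.rep_eq minus_mfps.rep_eq
  uminus_mfps.rep_eq mfps_const.rep_eq mfps_X.rep_eq mfps_deriv.rep_eq

lemma mfps_nth_sum: "mfps_nth (sum f A) m = (\<Sum>i\<in>A. mfps_nth (f i) m)"
  by (induction A rule: infinite_finite_induct) (auto simp: mfps_nth_simps)

lemma mfps_nth_const_mult: "mfps_nth (mfps_const c * f) m = c * mfps_nth f m"
proof -
  have "mfps_nth (mfps_const c * f) m = (\<Sum>a | a \<subseteq># m. if a = {#} then c * mfps_nth f m else 0)"
    unfolding times_mfps.rep_eq mfps_const.rep_eq by (rule sum.cong) auto
  then show ?thesis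
    by (simp add: finite_submultisets)
qed

lemma mfps_nth_X_mult:
  "mfps_nth (mfps_X i * f) m = (if i \<in># m then mfps_nth f (m - {#i#}) else 0)"
proof -
  have "mfps_nth (mfps_X i * f) m
      = (\<Sum>a | a \<subseteq># m. if a = {#i#} then mfps_nth f (m - {#i#}) else 0)"
    unfolding times_mfps.rep_eq mfps_X.rep_eq by (rule sum.cong) auto
  then show ?thesis
    by (simp add: finite_submultisets)
qed

lemma mfps_const_0 [simp]: "mfps_const 0 = 0"
  by (rule mfps_eqI) (simp add: mfps_nth_simps)

lemma mfps_const_1 [simp]: "mfps_const 1 = (1 :: ('a::comm_ring_1, 'n) mfps)"
  by (rule mfps_eqI) (simp add: mfps_nth_simps)

lemma mfps_const_add: "mfps_const (a + b) = mfps_const a + (mfps_const b :: ('a::comm_ring_1, 'n) mfps)"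
  by (rule mfps_eqI) (simp add: mfps_nth_simps)

lemma mfps_const_diff: "mfps_const (a - b) = mfps_const a - (mfps_const b :: ('a::comm_ring_1, 'n) mfps)"
  by (rule mfps_eqI) (simp add: mfps_nth_simps)

lemma mfps_const_mult: "mfps_const (a * b) = mfps_const a * (mfps_const b :: ('a::comm_ring_1, 'n) mfps)"
  by (rule mfps_eqI) (auto simp: mfps_nth_const_mult mfps_const.rep_eq)

lemma mfps_const_sum:
  "mfps_const (sum f A) = (\<Sum>i\<in>A. mfps_const (f i) :: ('a::comm_ring_1, 'n) mfps)"
  by (induction A rule: infinite_finite_induct) (simp_all add: mfps_const_add)

lemma mfps_const_mult_eq_0_iff:
  "mfps_const (c :: 'a :: idom) * f = 0 \<longleftrightarrow> c = 0 \<or> f = 0"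
proof
  assume "mfps_const c * f = 0"
  then have "c * mfps_nth f m = 0" for m
    by (metis mfps_nth_const_mult zero_mfps.rep_eq)
  then show "c = 0 \<or> f = 0"
    by (auto intro: mfps_eqI simp: zero_mfps.rep_eq)
qed auto


subsection \<open>Partial derivatives\<close>

lemma mfps_deriv_0 [simp]: "mfps_deriv i (0 :: ('a::comm_ring_1, 'n) mfps) = 0"
  by (rule mfps_eqI) (simp add: mfps_nth_simps)

lemma mfps_deriv_const [simp]: "mfps_deriv i (mfps_const c :: ('a::comm_ring_1, 'n) mfps) = 0"
  by (rule mfps_eqI) (simp add: mfps_nth_simps)

lemma mfps_deriv_X: "mfps_deriv i (mfps_X j :: ('a::comm_ring_1, 'n) mfps) = (if i = j then 1 else 0)"
  by (rule mfps_eqI) (auto simp: mfps_nth_simps)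

lemma mfps_deriv_add:
  "mfps_deriv i (f + g :: ('a::comm_ring_1, 'n) mfps) = mfps_deriv i f + mfps_deriv i g"
  by (rule mfps_eqI) (simp add: mfps_nth_simps algebra_simps)

lemma mfps_deriv_diff:
  "mfps_deriv i (f - g :: ('a::comm_ring_1, 'n) mfps) = mfps_deriv i f - mfps_deriv i g"
  by (rule mfps_eqI) (simp add: mfps_nth_simps algebra_simps)

lemma mfps_deriv_sum:
  "mfps_deriv i (sum f A :: ('a::comm_ring_1, 'n) mfps) = (\<Sum>j\<in>A. mfps_deriv i (f j))"
  by (induction A rule: infinite_finite_induct) (simp_all add: mfps_deriv_add)

lemma mfps_deriv_commute:
  "mfps_deriv i (mfps_deriv j f) = mfps_deriv j (mfps_deriv i (f :: ('a::comm_ring_1, 'n) mfps))"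
  by (rule mfps_eqI) (simp add: mfps_nth_simps add_mset_commute algebra_simps)

lemma mfps_nth_X_mult_deriv:
  "mfps_nth (mfps_X i * mfps_deriv i f) m = of_nat (count m i) * mfps_nth f m"
  for f :: "('a::comm_ring_1, 'n) mfps"
proof (cases "i \<in># m")
  case True
  then obtain k where "m = add_mset i k" by (meson multi_member_split)
  then show ?thesis
    by (simp add: mfps_nth_X_mult mfps_deriv.rep_eq)
next
  case False
  then show ?thesis
    by (simp add: mfps_nth_X_mult count_eq_zero_iff[THEN iffD2])
qed

text \<open>Multiplication by an indeterminate only shifts coefficients. The product rule can thus
  be proved for \<open>x_i d_i\<close>, which acts diagonally on monomials, instead of for the
  derivative itself.\<close>

lemma mfps_X_mult_cancel:
  assumes "mfps_X i * f = mfps_X i * (g :: ('a::comm_ring_1, 'n) mfps)"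
  shows "f = g"
proof (rule mfps_eqI)
  fix m
  show "mfps_nth f m = mfps_nth g m"
    using arg_cong[OF assms, of "\<lambda>h. mfps_nth h (add_mset i m)"] by (simp add: mfps_nth_X_mult)
qed

text \<open>The operator \<open>x\<^sub>i \<partial>\<^sub>i\<close> multiplies the coefficient of \<open>m\<close> by \<open>count m i\<close>, which is additive in \<open>m\<close>.\<close>
lemma mfps_deriv_mult:
  "mfps_deriv i (f * g) = mfps_deriv i f * g + f * mfps_deriv i (g :: ('a::comm_ring_1, 'n) mfps)"
proof (rule mfps_X_mult_cancel[of i], rule mfps_eqI)
  fix m :: "'n multiset"
  let ?E = "\<lambda>f. mfps_X i * mfps_deriv i (f :: ('a, 'n) mfps)"
  have "mfps_nth (?E f * g + f * ?E g) m = (\<Sum>a | a \<subseteq># m.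
      of_nat (count a i) * mfps_nth f a * mfps_nth g (m - a)
      + mfps_nth f a * (of_nat (count (m - a) i) * mfps_nth g (m - a)))"
    by (simp add: plus_mfps.rep_eq times_mfps.rep_eq[of "?E f"] times_mfps.rep_eq[of f "?E g"]
        mfps_nth_X_mult_deriv sum.distrib)
  also have "\<dots> = (\<Sum>a | a \<subseteq># m. of_nat (count m i) * (mfps_nth f a * mfps_nth g (m - a)))"
  proof (rule sum.cong)
    fix a assume "a \<in> {a. a \<subseteq># m}"
    then have "count a i \<le> count m i"
      by (simp add: mset_subset_eq_count)
    then have "(of_nat (count m i) :: 'a) = of_nat (count a i) + of_nat (count (m - a) i)"
      by (simp flip: of_nat_add)
    then show "of_nat (count a i) * mfps_nth f a * mfps_nth g (m - a)
        + mfps_nth f a * (of_nat (count (m - a) i) * mfps_nth g (m - a))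
        = of_nat (count m i) * (mfps_nth f a * mfps_nth g (m - a))"
      by (simp add: algebra_simps)
  qed simp
  also have "\<dots> = mfps_nth (?E (f * g)) m"
    by (simp add: mfps_nth_X_mult_deriv times_mfps.rep_eq[of f g] sum_distrib_left)
  finally show "mfps_nth (?E (f * g)) m
      = mfps_nth (mfps_X i * (mfps_deriv i f * g + f * mfps_deriv i g)) m"
    by (simp add: algebra_simps)
qed


subsection \<open>Lie derivatives and the divergence\<close>

lemma lie_derivative_0 [simp]: "lie_derivative g 0 = 0"
  by (simp add: lie_derivative_def)

lemma lie_derivative_const [simp]: "lie_derivative g (mfps_const c) = 0"
  by (simp add: lie_derivative_def)

lemma lie_derivative_X: "lie_derivative g (mfps_X i) = g $ i"
  by (simp add: lie_derivative_def mfps_deriv_X if_distrib[of "\<lambda>x. x * _"] cong: if_cong)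

lemma lie_derivative_add: "lie_derivative g (\<phi> + \<xi>) = lie_derivative g \<phi> + lie_derivative g \<xi>"
  by (simp add: lie_derivative_def mfps_deriv_add algebra_simps sum.distrib)

lemma lie_derivative_diff: "lie_derivative g (\<phi> - \<xi>) = lie_derivative g \<phi> - lie_derivative g \<xi>"
  by (simp add: lie_derivative_def mfps_deriv_diff algebra_simps sum_subtractf)

lemma lie_derivative_sum: "lie_derivative g (sum \<phi> A) = (\<Sum>i\<in>A. lie_derivative g (\<phi> i))"
  by (induction A rule: infinite_finite_induct) (simp_all add: lie_derivative_add)

lemma lie_derivative_mult:
  "lie_derivative g (\<phi> * \<xi>) = lie_derivative g \<phi> * \<xi> + \<phi> * lie_derivative g \<xi>"
  by (simp add: lie_derivative_def mfps_deriv_mult algebra_simps sum.distrib sum_distrib_left)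

lemma lie_derivative_const_mult:
  "lie_derivative g (mfps_const c * \<phi>) = mfps_const c * lie_derivative g \<phi>"
  by (simp add: lie_derivative_mult)

lemma lie_derivative_vf_diff: "lie_derivative (g - h) \<phi> = lie_derivative g \<phi> - lie_derivative h \<phi>"
  by (simp add: lie_derivative_def algebra_simps sum_subtractf)

lemma formal_div_altdef: "formal_div g = (\<Sum>i\<in>UNIV. mfps_deriv i (g $ i))"
  by (simp add: formal_div_def jacobian_matrix_def trace_def)

lemma formal_div_diff: "formal_div (g - h) = formal_div g - formal_div h"
  by (simp add: formal_div_altdef mfps_deriv_diff sum_subtractf)

lemma lie_bracket_nth: "lie_bracket g h $ i = lie_derivative g (h $ i) - lie_derivative h (g $ i)"
  by (simp add: lie_bracket_def jacobian_matrix_def matrix_vector_mult_def lie_derivative_def)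

text \<open>Separates the second-order part, which will cancel in the commutator, from the
  first-order part, which will give the bracket.\<close>

lemma lie_derivative_twice:
  "lie_derivative g (lie_derivative h \<phi>) = (\<Sum>i\<in>UNIV. \<Sum>j\<in>UNIV. mfps_deriv i (mfps_deriv j \<phi>) * g $ i * h $ j)
    + (\<Sum>j\<in>UNIV. mfps_deriv j \<phi> * lie_derivative g (h $ j))"
proof -
  have "lie_derivative g (lie_derivative h \<phi>)
      = (\<Sum>j\<in>UNIV. lie_derivative g (mfps_deriv j \<phi>) * h $ j)
        + (\<Sum>j\<in>UNIV. mfps_deriv j \<phi> * lie_derivative g (h $ j))"
    unfolding lie_derivative_def[of h] by (simp add: lie_derivative_sum lie_derivative_mult sum.distrib)
  also have "(\<Sum>j\<in>UNIV. lie_derivative g (mfps_deriv j \<phi>) * h $ j)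
      = (\<Sum>j\<in>UNIV. \<Sum>i\<in>UNIV. mfps_deriv i (mfps_deriv j \<phi>) * g $ i * h $ j)"
    by (simp add: lie_derivative_def sum_distrib_right)
  also have "\<dots> = (\<Sum>i\<in>UNIV. \<Sum>j\<in>UNIV. mfps_deriv i (mfps_deriv j \<phi>) * g $ i * h $ j)"
    by (rule sum.swap)
  finally show ?thesis .
qed

lemma lie_derivative_lie_bracket:
  "lie_derivative (lie_bracket g h) \<phi>
    = lie_derivative g (lie_derivative h \<phi>) - lie_derivative h (lie_derivative g \<phi>)"
proof -
  \<comment> \<open>Mixed partial derivatives commute, so the second-order part is symmetric in
    \<open>g\<close> and \<open>h\<close>.\<close>
  have "(\<Sum>i\<in>UNIV. \<Sum>j\<in>UNIV. mfps_deriv i (mfps_deriv j \<phi>) * g $ i * h $ j)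
      = (\<Sum>i\<in>UNIV. \<Sum>j\<in>UNIV. mfps_deriv i (mfps_deriv j \<phi>) * h $ i * g $ j)"
    by (subst sum.swap) (simp add: mfps_deriv_commute mult_ac cong: sum.cong)
  moreover have "lie_derivative (lie_bracket g h) \<phi>
      = (\<Sum>j\<in>UNIV. mfps_deriv j \<phi> * lie_derivative g (h $ j))
        - (\<Sum>j\<in>UNIV. mfps_deriv j \<phi> * lie_derivative h (g $ j))"
    by (simp add: lie_derivative_def[of "lie_bracket g h"] lie_bracket_nth algebra_simps sum_subtractf)
  ultimately show ?thesis
    by (simp add: lie_derivative_twice)
qed

text \<open>The product rule yields the derivative of the divergence and a remainder, which is the
  trace of \<open>Dh Dg\<close> and therefore symmetric in \<open>g\<close> and
  \<open>h\<close>.\<close>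

lemma formal_div_lie_derivative:
  "(\<Sum>i\<in>UNIV. mfps_deriv i (lie_derivative g (h $ i)))
    = lie_derivative g (formal_div h) + (\<Sum>i\<in>UNIV. \<Sum>j\<in>UNIV. mfps_deriv j (h $ i) * mfps_deriv i (g $ j))"
proof -
  have "lie_derivative g (formal_div h)
      = (\<Sum>i\<in>UNIV. \<Sum>j\<in>UNIV. mfps_deriv i (mfps_deriv j (h $ i)) * g $ j)"
    unfolding formal_div_altdef lie_derivative_sum
    by (simp add: lie_derivative_def mfps_deriv_commute cong: sum.cong)
  then show ?thesis
    by (simp add: lie_derivative_def mfps_deriv_sum mfps_deriv_mult sum.distrib)
qed

text \<open>The two traces of products of Jacobian matrices cancel. Both the first integral claim
  and the commutator formula for \<open>jacobi_op\<close> rest on this identity.\<close>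

lemma formal_div_lie_bracket:
  "formal_div (lie_bracket g h) = lie_derivative g (formal_div h) - lie_derivative h (formal_div g)"
proof -
  have "(\<Sum>i\<in>UNIV. \<Sum>j\<in>UNIV. mfps_deriv j (h $ i) * mfps_deriv i (g $ j))
      = (\<Sum>i\<in>UNIV. \<Sum>j\<in>UNIV. mfps_deriv j (g $ i) * mfps_deriv i (h $ j))"
    by (subst sum.swap) (simp add: mult.commute)
  then show ?thesis
    by (simp add: formal_div_altdef[of "lie_bracket g h"] lie_bracket_nth mfps_deriv_diff
        sum_subtractf formal_div_lie_derivative)
qed


subsection \<open>Series of finite support\<close>

lift_definition mfps_monom :: "'n multiset \<Rightarrow> 'a::zero \<Rightarrow> ('a, 'n) mfps"
  is "\<lambda>m c k. if k = m then c else 0" .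

lemma mfps_monom_empty: "mfps_monom {#} c = mfps_const c"
  by (rule mfps_eqI) (simp add: mfps_monom.rep_eq mfps_const.rep_eq)

lemma mfps_monom_add_mset:
  "mfps_monom (add_mset i m) c = mfps_X i * (mfps_monom m c :: ('a::comm_ring_1, 'n) mfps)"
  by (rule mfps_eqI) (auto simp: mfps_monom.rep_eq mfps_nth_X_mult)

text \<open>Polynomials are generated by constants and indeterminates. A property of linear vector
  fields that is compatible with sums and products then only has to be checked on
  coordinates.\<close>

lemma mfps_finite_support_induct [consumes 1, case_names const X add mult]:
  fixes f :: "('a::comm_ring_1, 'n) mfps"
  assumes "finite {m. mfps_nth f m \<noteq> 0}"
    and const: "\<And>c. P (mfps_const c)"
    and X: "\<And>i. P (mfps_X i)"
    and add: "\<And>f g. P f \<Longrightarrow> P g \<Longrightarrow> P (f + g)"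
    and mult: "\<And>f g. P f \<Longrightarrow> P g \<Longrightarrow> P (f * g)"
  shows "P f"
proof -
  have monom: "P (mfps_monom m c)" for m c
    by (induction m) (auto simp: mfps_monom_empty mfps_monom_add_mset const X mult)
  have "P (\<Sum>m\<in>F. mfps_monom m (mfps_nth f m))" if "finite F" for F
    using that
  proof (induction F)
    case empty
    then show ?case using const[of 0] by simp
  qed (simp add: monom add)
  moreover have "f = (\<Sum>m | mfps_nth f m \<noteq> 0. mfps_monom m (mfps_nth f m))"
    by (rule mfps_eqI) (use assms(1) in \<open>simp add: mfps_nth_sum mfps_monom.rep_eq\<close>)
  ultimately show ?thesis
    using assms(1) by metis
qed

lemma finite_multisets_of_size_less: "finite {m :: 'n::finite multiset. size m < d}"
proof (induction d)
  case (Suc d)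
  have "{m :: 'n multiset. size m < Suc d} \<subseteq> insert {#} (\<Union>i. add_mset i ` {m. size m < d})"
  proof
    fix m :: "'n multiset" assume "m \<in> {m. size m < Suc d}"
    then show "m \<in> insert {#} (\<Union>i. add_mset i ` {m. size m < d})"
      by (cases m) auto
  qed
  then show ?case
    by (rule finite_subset) (simp add: Suc.IH)
qed simp

text \<open>The bound is strict, which makes this complementary to \<open>order_ge d\<close>: what
  truncation removes has order at least \<open>d\<close>. Truncations are polynomials, to which
  induction on finite support applies.\<close>

lift_definition mfps_truncate :: "nat \<Rightarrow> ('a::zero, 'n) mfps \<Rightarrow> ('a, 'n) mfps"
  is "\<lambda>d f m. if size m < d then f m else 0" .

lemma finite_support_truncate:
  "finite {m. mfps_nth (mfps_truncate d (f :: ('a::zero, 'n::finite) mfps)) m \<noteq> 0}"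
  by (rule finite_subset[OF _ finite_multisets_of_size_less[of d]])
    (auto simp: mfps_truncate.rep_eq)


subsection \<open>The degree filtration\<close>

text \<open>A predicate instead of an order function, so that the zero series satisfies it for every
  \<open>d\<close>.\<close>

definition order_ge :: "nat \<Rightarrow> ('a::zero, 'n) mfps \<Rightarrow> bool" where
  "order_ge d f \<longleftrightarrow> (\<forall>m. size m < d \<longrightarrow> mfps_nth f m = 0)"

lemma order_ge_0 [simp]: "order_ge 0 f"
  by (simp add: order_ge_def)

lemma order_ge_zero [simp]: "order_ge d (0 :: ('a::comm_ring_1, 'n) mfps)"
  by (simp add: order_ge_def zero_mfps.rep_eq)

lemma order_ge_mono: "order_ge d f \<Longrightarrow> c \<le> d \<Longrightarrow> order_ge c f"
  by (simp add: order_ge_def)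

lemma order_ge_add: "order_ge d f \<Longrightarrow> order_ge d g \<Longrightarrow> order_ge d (f + g :: ('a::comm_ring_1, 'n) mfps)"
  by (simp add: order_ge_def plus_mfps.rep_eq)

lemma order_ge_diff: "order_ge d f \<Longrightarrow> order_ge d g \<Longrightarrow> order_ge d (f - g :: ('a::comm_ring_1, 'n) mfps)"
  by (simp add: order_ge_def minus_mfps.rep_eq)

lemma order_ge_sum:
  "(\<And>i. i \<in> A \<Longrightarrow> order_ge d (f i)) \<Longrightarrow> order_ge d (sum f A :: ('a::comm_ring_1, 'n) mfps)"
  by (simp add: order_ge_def mfps_nth_sum)

lemma order_ge_mult:
  assumes "order_ge c f" "order_ge d g"
  shows "order_ge (c + d) (f * g :: ('a::comm_ring_1, 'n) mfps)"
  unfolding order_ge_def times_mfps.rep_eq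
proof (intro allI impI sum.neutral ballI)
  fix m a :: "'n multiset"
  assume m: "size m < c + d" and "a \<in> {a. a \<subseteq># m}"
  then have "size m = size a + size (m - a)"
    by (metis mem_Collect_eq size_union subset_mset.add_diff_inverse)
  with m have "size a < c \<or> size (m - a) < d"
    by linarith
  with assms show "mfps_nth f a * mfps_nth g (m - a) = 0"
    by (auto simp: order_ge_def)
qed

lemma order_ge_deriv: "order_ge d f \<Longrightarrow> order_ge (d - 1) (mfps_deriv i (f :: ('a::comm_ring_1, 'n) mfps))"
  by (auto simp: order_ge_def mfps_deriv.rep_eq)

lemma order_ge_truncate_diff: "order_ge d (f - mfps_truncate d (f :: ('a::comm_ring_1, 'n) mfps))"
  by (simp add: order_ge_def minus_mfps.rep_eq mfps_truncate.rep_eq)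

lemma order_ge_lie_derivative:
  assumes "\<And>i. order_ge (Suc c) (g $ i)" "order_ge d \<phi>"
  shows "order_ge (d + c) (lie_derivative g \<phi>)"
  unfolding lie_derivative_def
proof (rule order_ge_sum)
  fix j
  \<comment> \<open>For \<open>d = 0\<close> the subtraction is truncated, but the bound
    \<open>d - 1 + Suc c\<close> is still at least \<open>d + c\<close>.\<close>
  have "order_ge (d - 1 + Suc c) (mfps_deriv j \<phi> * g $ j)"
    by (intro order_ge_mult order_ge_deriv assms)
  then show "order_ge (d + c) (mfps_deriv j \<phi> * g $ j)"
    by (rule order_ge_mono) simp
qed


subsection \<open>Linear vector fields\<close>

lemma linear_vf_nth: "linear_vf B $ i = (\<Sum>j\<in>UNIV. mfps_const (B $ i $ j) * mfps_X j)"
  by (simp add: linear_vf_def)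

lemma mfps_nth_linear_vf:
  "mfps_nth (linear_vf B $ i) m = (\<Sum>j\<in>UNIV. if m = {#j#} then B $ i $ j else 0)"
  by (simp add: linear_vf_nth mfps_nth_sum mfps_nth_const_mult mfps_X.rep_eq
      if_distrib[of "\<lambda>x. _ * x"] cong: if_cong)

lemma linear_vf_0 [simp]: "linear_vf 0 = 0"
  by (simp add: vec_eq_iff linear_vf_nth)

lemma linear_vf_mat_1: "linear_vf (mat 1) $ i = mfps_X i"
  by (simp add: linear_vf_nth mat_def if_distrib[of mfps_const] if_distrib[of "\<lambda>x. x * _"] cong: if_cong)

lemma linear_vf_mult: "linear_vf (A ** B) $ i = (\<Sum>j\<in>UNIV. mfps_const (A $ i $ j) * linear_vf B $ j)"
proof -
  have "linear_vf (A ** B) $ i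
      = (\<Sum>k\<in>UNIV. \<Sum>j\<in>UNIV. mfps_const (A $ i $ j) * mfps_const (B $ j $ k) * mfps_X k)"
    by (simp add: linear_vf_nth matrix_matrix_mult_def mfps_const_sum mfps_const_mult sum_distrib_right)
  also have "\<dots> = (\<Sum>j\<in>UNIV. \<Sum>k\<in>UNIV. mfps_const (A $ i $ j) * mfps_const (B $ j $ k) * mfps_X k)"
    by (rule sum.swap)
  finally show ?thesis
    by (simp add: linear_vf_nth sum_distrib_left mult.assoc)
qed

lemma lie_derivative_linear_vf: "lie_derivative g (linear_vf B $ i) = (\<Sum>j\<in>UNIV. mfps_const (B $ i $ j) * g $ j)"
  by (simp add: linear_vf_nth lie_derivative_sum lie_derivative_const_mult lie_derivative_X)

text \<open>On linear forms, written as rows of a matrix, the Lie derivative is right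
  multiplication. This turns nilpotency and diagonalizability of a matrix into statements about the
  action on coordinates.\<close>

lemma lie_derivative_linear_linear: "lie_derivative (linear_vf M) (linear_vf B $ i) = linear_vf (B ** M) $ i"
  by (simp add: lie_derivative_linear_vf linear_vf_mult)

lemma formal_div_linear_vf: "formal_div (linear_vf B) = mfps_const (trace B)"
proof -
  have "formal_div (linear_vf B) = (\<Sum>i\<in>UNIV. \<Sum>j\<in>UNIV. mfps_const (B $ i $ j) * (if i = j then 1 else 0))"
    by (simp add: formal_div_altdef linear_vf_nth mfps_deriv_sum mfps_deriv_mult mfps_deriv_X)
  also have "\<dots> = (\<Sum>i\<in>UNIV. mfps_const (B $ i $ i))"
    by (simp add: if_distrib[of "\<lambda>x. _ * x"] cong: if_cong)
  finally show ?thesis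
    by (simp add: trace_def mfps_const_sum)
qed

lemma order_ge_linear_vf: "order_ge 1 (linear_vf B $ i)"
  by (simp add: order_ge_def mfps_nth_linear_vf)

text \<open>The operator is a linear combination of the operators \<open>x_k d_j\<close>, each of
  which preserves the degree.\<close>

lemma lie_derivative_linear_vf_truncate:
  "lie_derivative (linear_vf B) (mfps_truncate d \<phi>) = mfps_truncate d (lie_derivative (linear_vf B) \<phi>)"
proof (rule mfps_eqI)
  fix m
  have nth: "mfps_nth (lie_derivative (linear_vf B) \<xi>) m
      = (\<Sum>j\<in>UNIV. \<Sum>k\<in>UNIV. B $ j $ k * mfps_nth (mfps_X k * mfps_deriv j \<xi>) m)" for \<xi>
  proof -
    have "lie_derivative (linear_vf B) \<xi>
        = (\<Sum>j\<in>UNIV. \<Sum>k\<in>UNIV. mfps_const (B $ j $ k) * (mfps_X k * mfps_deriv j \<xi>))"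
      by (simp add: lie_derivative_def linear_vf_nth sum_distrib_left mult_ac)
    then show ?thesis
      by (simp add: mfps_nth_sum mfps_nth_const_mult)
  qed
  have "mfps_nth (mfps_X k * mfps_deriv j (mfps_truncate d \<phi>)) m
      = (if size m < d then mfps_nth (mfps_X k * mfps_deriv j \<phi>) m else 0)" for j k
    by (auto simp: mfps_nth_X_mult mfps_deriv.rep_eq mfps_truncate.rep_eq
        dest!: multi_member_split)
  then show "mfps_nth (lie_derivative (linear_vf B) (mfps_truncate d \<phi>)) m
      = mfps_nth (mfps_truncate d (lie_derivative (linear_vf B) \<phi>)) m"
    by (simp add: nth mfps_truncate.rep_eq)
qed

subsection \<open>Nilpotent linear vector fields\<close>

lemma lie_derivative_funpow_0 [simp]: "(lie_derivative g ^^ n) 0 = 0"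
  by (induction n) simp_all

lemma lie_derivative_funpow_add:
  "(lie_derivative g ^^ n) (\<phi> + \<xi>) = (lie_derivative g ^^ n) \<phi> + (lie_derivative g ^^ n) \<xi>"
  by (induction n) (simp_all add: lie_derivative_add)

lemma lie_derivative_funpow_eq_0_mono:
  assumes "(lie_derivative g ^^ a) \<phi> = 0" "a \<le> b"
  shows "(lie_derivative g ^^ b) \<phi> = 0"
proof -
  have "(lie_derivative g ^^ b) \<phi> = (lie_derivative g ^^ (b - a)) ((lie_derivative g ^^ a) \<phi>)"
    using assms(2) by (simp flip: funpow_add comp_apply[of "_ ^^ _"])
  then show ?thesis
    by (simp add: assms(1))
qed

text \<open>Peeling off one application by the Leibniz rule lowers either \<open>a\<close> or
  \<open>b\<close> by one. Once one of them is 0, the corresponding factor is itself zero.\<close>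

lemma lie_derivative_funpow_mult_eq_0:
  "a + b \<le> n \<Longrightarrow> (lie_derivative g ^^ a) \<phi> = 0 \<Longrightarrow> (lie_derivative g ^^ b) \<xi> = 0
    \<Longrightarrow> (lie_derivative g ^^ n) (\<phi> * \<xi>) = 0"
proof (induction n arbitrary: a b \<phi> \<xi>)
  case 0
  then show ?case by simp
next
  case (Suc n)
  show ?case
  proof (cases "a = 0 \<or> b = 0")
    case True
    with Suc.prems have "\<phi> * \<xi> = 0" by auto
    then show ?thesis by (simp del: funpow.simps)
  next
    case False
    then obtain a' b' where ab: "a = Suc a'" "b = Suc b'"
      by (meson not0_implies_Suc)
    have "(lie_derivative g ^^ n) (lie_derivative g \<phi> * \<xi>) = 0"
      by (rule Suc.IH[of a' b]) (use Suc.prems ab in \<open>simp_all add: funpow_Suc_right del: funpow.simps\<close>)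
    moreover have "(lie_derivative g ^^ n) (\<phi> * lie_derivative g \<xi>) = 0"
      by (rule Suc.IH[of a b']) (use Suc.prems ab in \<open>simp_all add: funpow_Suc_right del: funpow.simps\<close>)
    ultimately show ?thesis
      by (simp add: funpow_Suc_right lie_derivative_mult lie_derivative_funpow_add del: funpow.simps)
  qed
qed

text \<open>Nilpotency is local: the exponent depends on the polynomial. On coordinates it comes
  from the powers of \<open>N\<close>; for a sum the maximum of the exponents works, for a product
  their sum.\<close>

lemma lie_derivative_nilpotent_finite_support:
  assumes "nilpotent_matrix N" and "finite {m. mfps_nth \<phi> m \<noteq> 0}"
  shows "\<exists>k. (lie_derivative (linear_vf N) ^^ k) \<phi> = 0"
  using assms(2)
proof (induction rule: mfps_finite_support_induct)
  case (const c)
  show ?case by (rule exI[of _ 1]) simp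
next
  case (X i)
  obtain k where k: "((\<lambda>M. N ** M) ^^ k) (mat 1) = 0"
    using assms(1) by (auto simp: nilpotent_matrix_def)
  \<comment> \<open>Stated for arbitrary \<open>B\<close>, since each application replaces
    \<open>B\<close> by \<open>B ** N\<close>; the identity matrix then gives the
    coordinates.\<close>
  have "(lie_derivative (linear_vf N) ^^ k) (linear_vf B $ i)
      = linear_vf (B ** ((\<lambda>M. N ** M) ^^ k) (mat 1)) $ i" for k B
  proof (induction k arbitrary: B)
    case (Suc k)
    have "(lie_derivative (linear_vf N) ^^ Suc k) (linear_vf B $ i)
        = (lie_derivative (linear_vf N) ^^ k) (linear_vf (B ** N) $ i)"
      by (simp add: funpow_Suc_right lie_derivative_linear_linear del: funpow.simps)
    then show ?case
      by (simp add: Suc.IH matrix_mul_assoc)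
  qed simp
  from this[of k "mat 1"] have "(lie_derivative (linear_vf N) ^^ k) (mfps_X i) = 0"
    by (simp add: k linear_vf_mat_1)
  then show ?case ..
next
  case (add \<phi> \<xi>)
  then obtain a b where "(lie_derivative (linear_vf N) ^^ a) \<phi> = 0" "(lie_derivative (linear_vf N) ^^ b) \<xi> = 0"
    by blast
  then have "(lie_derivative (linear_vf N) ^^ max a b) \<phi> = 0" "(lie_derivative (linear_vf N) ^^ max a b) \<xi> = 0"
    by (auto intro: lie_derivative_funpow_eq_0_mono)
  then have "(lie_derivative (linear_vf N) ^^ max a b) (\<phi> + \<xi>) = 0"
    by (simp add: lie_derivative_funpow_add)
  then show ?case ..
next
  case (mult \<phi> \<xi>)
  then obtain a b where "(lie_derivative (linear_vf N) ^^ a) \<phi> = 0" "(lie_derivative (linear_vf N) ^^ b) \<xi> = 0"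
    by blast
  then have "(lie_derivative (linear_vf N) ^^ (a + b)) (\<phi> * \<xi>) = 0"
    by (rule lie_derivative_funpow_mult_eq_0[OF order_refl])
  then show ?case ..
qed


subsection \<open>Sums of eigenvectors\<close>

text \<open>The summands are indexed by their eigenvalues, which are thus automatically distinct; a
  summand may be zero.\<close>

definition eigenvector_sum :: "('n::finite) formal_vf \<Rightarrow> (complex, 'n) mfps \<Rightarrow> bool" where
  "eigenvector_sum g \<phi> \<longleftrightarrow> (\<exists>F w. finite F \<and>
    (\<forall>\<mu>\<in>F. lie_derivative g (w \<mu>) = mfps_const \<mu> * w \<mu>) \<and> \<phi> = (\<Sum>\<mu>\<in>F. w \<mu>))"

lemma eigenvector_sum_0 [simp]: "eigenvector_sum g 0"
  unfolding eigenvector_sum_def by (rule exI[of _ "{}"]) simp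

lemma eigenvector_sum_single:
  "lie_derivative g \<phi> = mfps_const \<mu> * \<phi> \<Longrightarrow> eigenvector_sum g \<phi>"
  unfolding eigenvector_sum_def
  by (rule exI[of _ "{\<mu>}"], rule exI[of _ "\<lambda>_. \<phi>"]) simp

lemma eigenvector_sum_add:
  assumes "eigenvector_sum g \<phi>" "eigenvector_sum g \<xi>"
  shows "eigenvector_sum g (\<phi> + \<xi>)"
proof -
  obtain F u where F: "finite F" "\<phi> = (\<Sum>\<mu>\<in>F. u \<mu>)"
    "\<And>\<mu>. \<mu> \<in> F \<Longrightarrow> lie_derivative g (u \<mu>) = mfps_const \<mu> * u \<mu>"
    using assms(1) unfolding eigenvector_sum_def by blast
  obtain G v where G: "finite G" "\<xi> = (\<Sum>\<mu>\<in>G. v \<mu>)"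
    "\<And>\<mu>. \<mu> \<in> G \<Longrightarrow> lie_derivative g (v \<mu>) = mfps_const \<mu> * v \<mu>"
    using assms(2) unfolding eigenvector_sum_def by blast
  \<comment> \<open>Eigenvectors for a common eigenvalue are merged, with 0 as default where a
    family has no member.\<close>
  define w where "w \<mu> = (if \<mu> \<in> F then u \<mu> else 0) + (if \<mu> \<in> G then v \<mu> else 0)" for \<mu>
  have "\<forall>\<mu>\<in>F \<union> G. lie_derivative g (w \<mu>) = mfps_const \<mu> * w \<mu>"
    by (simp add: w_def lie_derivative_add F(3) G(3) algebra_simps)
  moreover have "(\<Sum>\<mu>\<in>F \<union> G. if \<mu> \<in> F then u \<mu> else 0) = \<phi>"
    unfolding F(2) by (rule sum.mono_neutral_cong_right) (use F(1) G(1) in auto)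
  moreover have "(\<Sum>\<mu>\<in>F \<union> G. if \<mu> \<in> G then v \<mu> else 0) = \<xi>"
    unfolding G(2) by (rule sum.mono_neutral_cong_right) (use F(1) G(1) in auto)
  ultimately have "finite (F \<union> G) \<and> (\<forall>\<mu>\<in>F \<union> G. lie_derivative g (w \<mu>) = mfps_const \<mu> * w \<mu>)
      \<and> \<phi> + \<xi> = (\<Sum>\<mu>\<in>F \<union> G. w \<mu>)"
    using F(1) G(1) by (simp add: w_def sum.distrib)
  then show ?thesis
    unfolding eigenvector_sum_def by blast
qed

lemma eigenvector_sum_sum:
  "(\<And>i. i \<in> A \<Longrightarrow> eigenvector_sum g (\<phi> i)) \<Longrightarrow> eigenvector_sum g (sum \<phi> A)"
  by (induction A rule: infinite_finite_induct) (simp_all add: eigenvector_sum_add)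

lemma eigenvector_sum_mult:
  assumes "eigenvector_sum g \<phi>" "eigenvector_sum g \<xi>"
  shows "eigenvector_sum g (\<phi> * \<xi>)"
proof -
  obtain F u where F: "\<phi> = (\<Sum>\<mu>\<in>F. u \<mu>)"
    "\<And>\<mu>. \<mu> \<in> F \<Longrightarrow> lie_derivative g (u \<mu>) = mfps_const \<mu> * u \<mu>"
    using assms(1) unfolding eigenvector_sum_def by blast
  obtain G v where G: "\<xi> = (\<Sum>\<mu>\<in>G. v \<mu>)"
    "\<And>\<mu>. \<mu> \<in> G \<Longrightarrow> lie_derivative g (v \<mu>) = mfps_const \<mu> * v \<mu>"
    using assms(2) unfolding eigenvector_sum_def by blast
  \<comment> \<open>Eigenvalues of a derivation add under products. Different pairs may have the
    same sum, so each product is treated as a separate sum of eigenvectors.\<close>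
  have "eigenvector_sum g (u \<mu> * v \<nu>)" if "\<mu> \<in> F" "\<nu> \<in> G" for \<mu> \<nu>
    by (rule eigenvector_sum_single[where \<mu> = "\<mu> + \<nu>"])
      (simp add: lie_derivative_mult F(2) G(2) that mfps_const_add algebra_simps)
  then show ?thesis
    unfolding F(1) G(1) sum_product by (intro eigenvector_sum_sum)
qed

text \<open>Applying \<open>X_g - \<nu>\<close> to the relation removes the summand for \<nu> and
  scales each other one by the nonzero number \<mu> - \<nu>.\<close>

lemma eigenvectors_independent:
  assumes "finite F" and "\<And>\<mu>. \<mu> \<in> F \<Longrightarrow> lie_derivative g (w \<mu>) = mfps_const \<mu> * w \<mu>"
    and "(\<Sum>\<mu>\<in>F. w \<mu>) = 0"
  shows "\<forall>\<mu>\<in>F. w \<mu> = 0"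
  using assms
proof (induction F arbitrary: w)
  case (insert \<nu> F)
  have "0 = lie_derivative g (\<Sum>\<mu>\<in>insert \<nu> F. w \<mu>) - mfps_const \<nu> * (\<Sum>\<mu>\<in>insert \<nu> F. w \<mu>)"
    by (simp only: insert.prems(2) lie_derivative_0 mult_zero_right diff_zero)
  also have "\<dots> = (\<Sum>\<mu>\<in>insert \<nu> F. mfps_const (\<mu> - \<nu>) * w \<mu>)"
    unfolding lie_derivative_sum sum_distrib_left sum_subtractf[symmetric]
    by (rule sum.cong) (simp_all add: insert.prems(1) mfps_const_diff algebra_simps del: insert_iff)
  also have "\<dots> = (\<Sum>\<mu>\<in>F. mfps_const (\<mu> - \<nu>) * w \<mu>)"
    using insert.hyps by simp
  finally have "\<forall>\<mu>\<in>F. mfps_const (\<mu> - \<nu>) * w \<mu> = 0"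
    by (intro insert.IH) (simp_all add: lie_derivative_const_mult insert.prems(1) mult.left_commute)
  then have "\<forall>\<mu>\<in>F. w \<mu> = 0"
    using insert.hyps by (auto simp: mfps_const_mult_eq_0_iff)
  then show ?case
    using insert.prems(2) insert.hyps by simp
qed simp

text \<open>The iterated operator scales \<open>w \<mu>\<close> by \<open>(\<mu> - c) ^ k\<close>.
  By independence each scaled summand vanishes, so every nonzero summand has eigenvalue
  \<open>c\<close>.\<close>

lemma eigenvector_sum_generalized_kernel:
  fixes c :: complex
  assumes "eigenvector_sum g \<phi>" and "((\<lambda>\<xi>. lie_derivative g \<xi> - mfps_const c * \<xi>) ^^ k) \<phi> = 0"
  shows "lie_derivative g \<phi> - mfps_const c * \<phi> = 0"
proof -
  define L where "L \<xi> = lie_derivative g \<xi> - mfps_const c * \<xi>" for \<xi>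
  obtain F w where F: "finite F" "\<phi> = (\<Sum>\<mu>\<in>F. w \<mu>)"
    "\<And>\<mu>. \<mu> \<in> F \<Longrightarrow> lie_derivative g (w \<mu>) = mfps_const \<mu> * w \<mu>"
    using assms(1) unfolding eigenvector_sum_def by blast
  have L_sum: "L (\<Sum>\<mu>\<in>F. mfps_const (a \<mu>) * w \<mu>) = (\<Sum>\<mu>\<in>F. mfps_const ((\<mu> - c) * a \<mu>) * w \<mu>)" for a
    unfolding L_def lie_derivative_sum sum_distrib_left sum_subtractf[symmetric]
    by (rule sum.cong)
      (simp_all add: lie_derivative_mult F(3) mfps_const_diff mfps_const_mult algebra_simps)
  have L_pow: "(L ^^ j) \<phi> = (\<Sum>\<mu>\<in>F. mfps_const ((\<mu> - c) ^ j) * w \<mu>)" for j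
    by (induction j) (simp_all add: F(2) L_sum)
  have "(L ^^ k) \<phi> = 0"
    using assms(2) by (simp add: L_def[abs_def])
  then have "\<forall>\<mu>\<in>F. mfps_const ((\<mu> - c) ^ k) * w \<mu> = 0"
    using F(1) by (intro eigenvectors_independent[where g = g])
      (simp_all add: L_pow lie_derivative_const_mult F(3) mult.left_commute)
  then have "\<forall>\<mu>\<in>F. mfps_const (\<mu> - c) * w \<mu> = 0"
    by (auto simp: mfps_const_mult_eq_0_iff)
  then have "L \<phi> = 0"
    using L_pow[of 1] by simp
  then show ?thesis
    by (simp add: L_def)
qed

text \<open>The rows of the inverse of \<open>P\<close> are linear forms that are eigenvectors, and
  \<open>P\<close> expresses the coordinates through them. Sums and products extend this to all
  polynomials.\<close>

lemma semisimple_eigenvector_sum: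
  assumes "semisimple_matrix S" and "finite {m. mfps_nth \<phi> m \<noteq> 0}"
  shows "eigenvector_sum (linear_vf S) \<phi>"
  using assms(2)
proof (induction rule: mfps_finite_support_induct)
  case (const c)
  show ?case by (rule eigenvector_sum_single[where \<mu> = 0]) simp
next
  case (X i)
  obtain P D :: "complex ^ 'a ^ 'a" where P: "invertible P"
    and D: "\<forall>i j. i \<noteq> j \<longrightarrow> D $ i $ j = 0" and S: "S = P ** D ** matrix_inv P"
    using assms(1) by (auto simp: semisimple_matrix_def)
  let ?Q = "matrix_inv P"
  have PQ: "P ** ?Q = mat 1" and QP: "?Q ** P = mat 1"
    using P someI_ex[of "\<lambda>A. P ** A = mat 1 \<and> A ** P = mat 1"]
    by (simp_all add: invertible_def matrix_inv_def)
  \<comment> \<open>The rows of \<open>?Q\<close> are left eigenvectors of \<open>S\<close>, with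
    the diagonal entries of \<open>D\<close> as eigenvalues.\<close>
  have QS: "?Q ** S = D ** ?Q"
    by (simp add: S matrix_mul_assoc QP)
  have "eigenvector_sum (linear_vf S) (mfps_const c * linear_vf ?Q $ j)" for c j
  proof (rule eigenvector_sum_single[where \<mu> = "D $ j $ j"])
    have "lie_derivative (linear_vf S) (linear_vf ?Q $ j)
        = (\<Sum>k\<in>UNIV. mfps_const (D $ j $ k) * linear_vf ?Q $ k)"
      by (simp add: lie_derivative_linear_linear QS linear_vf_mult)
    also have "\<dots> = (\<Sum>k\<in>UNIV. if k = j then mfps_const (D $ j $ j) * linear_vf ?Q $ j else 0)"
      by (rule sum.cong) (use D in auto)
    finally show "lie_derivative (linear_vf S) (mfps_const c * linear_vf ?Q $ j)
        = mfps_const (D $ j $ j) * (mfps_const c * linear_vf ?Q $ j)"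
      by (simp add: lie_derivative_const_mult mult.left_commute)
  qed
  then have "eigenvector_sum (linear_vf S) (linear_vf (P ** ?Q) $ i)"
    unfolding linear_vf_mult by (intro eigenvector_sum_sum)
  then show ?case
    by (simp add: PQ linear_vf_mat_1)
qed (simp_all add: eigenvector_sum_add eigenvector_sum_mult)


subsection \<open>The operator whose kernel consists of the inverse Jacobi multipliers\<close>

definition jacobi_op :: "('n::finite) formal_vf \<Rightarrow> (complex, 'n) mfps \<Rightarrow> (complex, 'n) mfps" where
  "jacobi_op g \<phi> = lie_derivative g \<phi> - formal_div g * \<phi>"

lemma jacobi_op_diff: "jacobi_op g (\<phi> - \<xi>) = jacobi_op g \<phi> - jacobi_op g \<xi>"
  by (simp add: jacobi_op_def lie_derivative_diff algebra_simps)

lemma jacobi_op_uminus: "jacobi_op g (- \<phi>) = - jacobi_op g \<phi>"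
  using jacobi_op_diff[of g 0 \<phi>] by (simp add: jacobi_op_def)

lemma jacobi_op_vf_diff: "jacobi_op (g - h) \<phi> = jacobi_op g \<phi> - jacobi_op h \<phi>"
  by (simp add: jacobi_op_def lie_derivative_vf_diff formal_div_diff algebra_simps)

text \<open>In the commutator the terms \<open>div g * div h\<close> and the mixed first-order terms
  cancel. The product rule leaves \<open>X_g (div h) - X_h (div g)\<close>, the divergence of the
  bracket.\<close>

lemma jacobi_op_lie_bracket:
  "jacobi_op (lie_bracket g h) \<phi> = jacobi_op g (jacobi_op h \<phi>) - jacobi_op h (jacobi_op g \<phi>)"
  by (simp add: jacobi_op_def lie_derivative_lie_bracket formal_div_lie_bracket
      lie_derivative_diff lie_derivative_mult algebra_simps)

lemma jacobi_op_vf_0 [simp]: "jacobi_op 0 \<phi> = 0"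
  by (simp add: jacobi_op_def lie_derivative_def formal_div_altdef)

lemma jacobi_op_linear_vf: "jacobi_op (linear_vf B) \<phi> = lie_derivative (linear_vf B) \<phi> - mfps_const (trace B) * \<phi>"
  by (simp add: jacobi_op_def formal_div_linear_vf)

lemma jacobi_op_linear_vf_truncate:
  "jacobi_op (linear_vf B) (mfps_truncate d \<phi>) = mfps_truncate d (jacobi_op (linear_vf B) \<phi>)"
  by (rule mfps_eqI)
    (simp add: jacobi_op_linear_vf lie_derivative_linear_vf_truncate minus_mfps.rep_eq
      mfps_nth_const_mult mfps_truncate.rep_eq)

lemma jacobi_op_funpow_linear_vf_truncate:
  "(jacobi_op (linear_vf B) ^^ k) (mfps_truncate d \<phi>) = mfps_truncate d ((jacobi_op (linear_vf B) ^^ k) \<phi>)"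
  by (induction k) (simp_all add: jacobi_op_linear_vf_truncate)

section \<open>Iterates of the operator raise the order when the linear part is nilpotent\<close>

lemma order_ge_linear_vf_remainder:
  assumes "mfps_nth (g $ i) {#} = 0"
  shows "order_ge 2 ((g - linear_vf (linear_part g)) $ i)"
  unfolding order_ge_def
proof (intro allI impI)
  fix m :: "'a multiset" assume "size m < 2"
  then consider "m = {#}" | j where "m = {#j#}"
    by (metis One_nat_def Suc_1 less_Suc_eq not_less_zero size_1_singleton_mset size_eq_0_iff_empty)
  then show "mfps_nth ((g - linear_vf (linear_part g)) $ i) m = 0"
    by cases (simp_all add: minus_mfps.rep_eq mfps_nth_linear_vf assms linear_part_def)
qed

text \<open>The constant term of the divergence is the trace of the linear part.\<close>

lemma order_ge_formal_div:
  assumes "trace (linear_part g) = 0"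
  shows "order_ge 1 (formal_div g)"
  using assms
  by (simp add: order_ge_def formal_div_altdef mfps_nth_sum mfps_deriv.rep_eq trace_def linear_part_def)

text \<open>On series of order at least \<open>d\<close>, modulo order \<open>Suc d\<close>, the
  operator agrees with the Lie derivative along the linear part, which is nilpotent on
  polynomials.\<close>

lemma jacobi_op_raises_order:
  assumes const: "\<And>i. mfps_nth (g $ i) {#} = 0" and nil: "nilpotent_matrix (linear_part g)"
    and \<phi>: "order_ge d \<phi>"
  shows "\<exists>k. order_ge (Suc d) ((jacobi_op g ^^ k) \<phi>)"
proof -
  let ?X = "lie_derivative (linear_vf (linear_part g))"
  let ?h = "g - linear_vf (linear_part g)"
  have X: "order_ge c (?X \<xi>)" if "order_ge c \<xi>" for c \<xi>
    using order_ge_lie_derivative[of 0 "linear_vf (linear_part g)", OF _ that]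
      order_ge_linear_vf[of "linear_part g"]
    by simp
  have Xk: "order_ge c ((?X ^^ k) \<xi>)" if "order_ge c \<xi>" for c \<xi> k
    by (induction k) (simp_all add: X that)
  \<comment> \<open>The discarded terms both gain a degree: \<open>?h\<close> starts in degree 2,
    and the divergence has zero constant term because a nilpotent matrix has trace zero.\<close>
  have step: "order_ge (Suc d) (jacobi_op g \<xi> - ?X \<xi>)" if "order_ge d \<xi>" for \<xi>
  proof -
    have "jacobi_op g \<xi> - ?X \<xi> = lie_derivative ?h \<xi> - formal_div g * \<xi>"
      by (simp add: jacobi_op_def lie_derivative_vf_diff)
    moreover have "order_ge (d + 1) (lie_derivative ?h \<xi>)"
      using order_ge_linear_vf_remainder[OF const] that
      by (intro order_ge_lie_derivative) (simp_all add: numeral_2_eq_2)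
    moreover have "order_ge (1 + d) (formal_div g * \<xi>)"
      using that trace_nilpotent_matrix[OF nil] by (intro order_ge_mult order_ge_formal_div)
    ultimately show ?thesis
      by (simp add: order_ge_diff)
  qed
  have diff: "order_ge (Suc d) ((jacobi_op g ^^ k) \<phi> - (?X ^^ k) \<phi>)" for k
  proof (induction k)
    case (Suc k)
    let ?a = "(jacobi_op g ^^ k) \<phi>" and ?b = "(?X ^^ k) \<phi>"
    \<comment> \<open>This bounds the order of \<open>?a\<close>, so that \<open>step\<close>
      applies to it; the rest of the difference is \<open>?X (?a - ?b)\<close>, whose order
      \<open>?X\<close> does not lower.\<close>
    have "order_ge d (?a - ?b + ?b)"
      using Suc.IH Xk[OF \<phi>] by (intro order_ge_add) (auto intro: order_ge_mono)
    then have "order_ge (Suc d) (jacobi_op g ?a - ?X ?a + ?X (?a - ?b))"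
      using Suc.IH by (intro order_ge_add step X) simp_all
    then show ?case
      by (simp add: lie_derivative_diff)
  qed simp
  obtain k where k: "(?X ^^ k) (mfps_truncate (Suc d) \<phi>) = 0"
    using lie_derivative_nilpotent_finite_support[OF nil finite_support_truncate] by blast
  \<comment> \<open>The part of degree at most \<open>d\<close> is annihilated; the tail keeps its
    order at least \<open>Suc d\<close>.\<close>
  have "(?X ^^ k) \<phi> = (?X ^^ k) (mfps_truncate (Suc d) \<phi>) + (?X ^^ k) (\<phi> - mfps_truncate (Suc d) \<phi>)"
    by (simp flip: lie_derivative_funpow_add)
  then have "order_ge (Suc d) ((?X ^^ k) \<phi>)"
    by (simp add: k Xk order_ge_truncate_diff)
  with diff[of k] have "order_ge (Suc d) ((jacobi_op g ^^ k) \<phi> - (?X ^^ k) \<phi> + (?X ^^ k) \<phi>)"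
    by (rule order_ge_add)
  then show ?thesis
    by auto
qed

lemma jacobi_op_funpow_order:
  assumes "\<And>i. mfps_nth (g $ i) {#} = 0" and "nilpotent_matrix (linear_part g)"
  shows "\<exists>k. order_ge d ((jacobi_op g ^^ k) \<phi>)"
proof (induction d)
  case (Suc d)
  then obtain k where "order_ge d ((jacobi_op g ^^ k) \<phi>)" ..
  from jacobi_op_raises_order[OF assms this] obtain j
    where "order_ge (Suc d) ((jacobi_op g ^^ j) ((jacobi_op g ^^ k) \<phi>))" ..
  then have "order_ge (Suc d) ((jacobi_op g ^^ (j + k)) \<phi>)"
    by (simp add: funpow_add)
  then show ?case ..
qed simp

section \<open>Passing from the normal form to its semisimple linear part\<close>

lemma jacobi_op_normal_form_kernel:
  assumes nf: "poincare_dulac_normal_form f S" and \<psi>: "jacobi_op f \<psi> = 0"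
  shows "jacobi_op (linear_vf S) \<psi> = 0"
proof -
  let ?L = "jacobi_op (linear_vf S)" and ?g = "f - linear_vf S"
  let ?N = "jacobi_op ?g"
  have const: "mfps_nth (f $ i) {#} = 0" for i
    using nf by (simp add: poincare_dulac_normal_form_def)
  have S: "semisimple_matrix S" and nil: "nilpotent_matrix (linear_part f - S)"
    and bracket: "lie_bracket (linear_vf S) f = 0"
    using nf by (simp_all add: poincare_dulac_normal_form_def is_semisimple_part_def)
  have const_g: "mfps_nth (?g $ i) {#} = 0" for i
    by (simp add: minus_mfps.rep_eq const mfps_nth_linear_vf)
  \<comment> \<open>Removing \<open>S\<close> leaves the nilpotent part of the Jordan-Chevalley
    decomposition, so powers of \<open>?N\<close> raise the order.\<close>
  have "linear_part ?g = linear_part f - S"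
    by (simp add: vec_eq_iff linear_part_def minus_mfps.rep_eq mfps_nth_linear_vf)
  with nil have nil_g: "nilpotent_matrix (linear_part ?g)"
    by simp
  have "?L (jacobi_op f \<phi>) = jacobi_op f (?L \<phi>)" for \<phi>
    using jacobi_op_lie_bracket[of "linear_vf S" f \<phi>] by (simp add: bracket)
  then have commute: "?L (?N \<phi>) = ?N (?L \<phi>)" for \<phi>
    by (simp add: jacobi_op_vf_diff jacobi_op_diff)
  then have commute_pow: "?L ((?N ^^ k) \<phi>) = (?N ^^ k) (?L \<phi>)" for k \<phi>
    by (induction k) simp_all
  have "?L \<psi> = - ?N \<psi>"
    by (simp add: jacobi_op_vf_diff \<psi>)
  then have L_N: "?L ((?N ^^ k) \<psi>) = - (?N ^^ Suc k) \<psi>" for k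
  proof -
    have "(?N ^^ k) (- \<phi>) = - (?N ^^ k) \<phi>" for \<phi>
      by (induction k) (simp_all add: jacobi_op_uminus)
    with \<open>?L \<psi> = - ?N \<psi>\<close> show ?thesis
      by (simp add: commute_pow funpow_swap1)
  qed
  \<comment> \<open>The sign is left open because it does not affect the order.\<close>
  have L_pow: "(?L ^^ k) \<psi> = (?N ^^ k) \<psi> \<or> (?L ^^ k) \<psi> = - (?N ^^ k) \<psi>" for k
  proof (induction k)
    case (Suc k)
    then show ?case
      using L_N[of k] by (auto simp: jacobi_op_uminus)
  qed simp
  \<comment> \<open>Since \<open>?L\<close> commutes with truncation, the truncated \<psi> is a
    polynomial in the generalized kernel of the diagonalizable operator \<open>?L\<close>, hence in
    its kernel.\<close>
  have trunc: "mfps_truncate d (?L \<psi>) = 0" for d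
  proof -
    obtain k where "order_ge d ((?N ^^ k) \<psi>)"
      using jacobi_op_funpow_order[OF const_g nil_g] by blast
    then have "order_ge d ((?L ^^ k) \<psi>)"
      using L_pow[of k] order_ge_diff[of d 0 "(?N ^^ k) \<psi>"] by auto
    then have "mfps_truncate d ((?L ^^ k) \<psi>) = 0"
      by (auto intro!: mfps_eqI simp: order_ge_def mfps_truncate.rep_eq zero_mfps.rep_eq)
    then have "(?L ^^ k) (mfps_truncate d \<psi>) = 0"
      by (simp add: jacobi_op_funpow_linear_vf_truncate)
    then have "?L (mfps_truncate d \<psi>) = 0"
      using eigenvector_sum_generalized_kernel[OF semisimple_eigenvector_sum[OF S finite_support_truncate]]
      unfolding jacobi_op_linear_vf[abs_def] by blast
    then show ?thesis
      by (simp add: jacobi_op_linear_vf_truncate)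
  qed
  show ?thesis
  proof (rule mfps_eqI)
    fix m
    show "mfps_nth (?L \<psi>) m = mfps_nth 0 m"
      \<comment> \<open>The smallest truncation that retains the coefficient of
        \<open>m\<close>.\<close>
      using arg_cong[OF trunc[of "Suc (size m)"], of "\<lambda>\<phi>. mfps_nth \<phi> m"]
      by (simp add: mfps_truncate.rep_eq)
  qed
qed

theorem proposition14:
  fixes f :: "('n::finite) formal_vf" and A\<^sub>s :: "complex ^ 'n ^ 'n"
  assumes "poincare_dulac_normal_form f A\<^sub>s"
  shows "first_integral (linear_vf A\<^sub>s) (formal_div f) \<and>
    (\<forall>\<psi>. inverse_jacobi_multiplier f \<psi> \<longrightarrow>
      lie_derivative (linear_vf A\<^sub>s) \<psi> = formal_div (linear_vf A\<^sub>s) * \<psi>)"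
proof (intro conjI allI impI)
  have "lie_bracket (linear_vf A\<^sub>s) f = 0"
    using assms by (simp add: poincare_dulac_normal_form_def)
  then have "formal_div (lie_bracket (linear_vf A\<^sub>s) f) = 0"
    by (simp add: formal_div_altdef)
  \<comment> \<open>The divergence of a linear field is constant, so its derivative along
    \<open>f\<close> vanishes and only the derivative of \<open>formal_div f\<close>
    remains.\<close>
  then show "first_integral (linear_vf A\<^sub>s) (formal_div f)"
    by (simp add: formal_div_lie_bracket formal_div_linear_vf first_integral_def)
next
  fix \<psi> assume "inverse_jacobi_multiplier f \<psi>"
  then have "jacobi_op f \<psi> = 0"
    by (simp add: inverse_jacobi_multiplier_def jacobi_op_def)
  then show "lie_derivative (linear_vf A\<^sub>s) \<psi> = formal_div (linear_vf A\<^sub>s) * \<psi>"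
    using jacobi_op_normal_form_kernel[OF assms] by (simp add: jacobi_op_def)
qed

end
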